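(* For every integer $n\ge 0$, $$\tilde{F}_{n+1}=\sum_{i=0}^{n}\sum_{j=0}^{i-1}\binom{n}{i}\binom{i}{j}\tilde{F}_{j}\,F_{i-j}.$$
   Context: For $n\ge 0$ let $[n]=\{1,\dots,n\}$. A partition of $[n]$ into $k$ blocks is written $B_1|B_2|\cdots|B_k$, with non-empty disjoint blocks whose union is $[n]$, listed so that $\min B_1<\min B_2<\cdots<\min B_k$. A deranged partition of $[n]$ is an arrangement $B_{\sigma(1)}|B_{\sigma(2)}|\cdots|B_{\sigma(k)}$ of the blocks of some partition $B_1|\cdots|B_k$ of $[n]$, where $\sigma$ is a permutation of $[k]$ such that $B_{\sigma(i)}\neq B_i$ for all $1\le i\le k$ (i.e. $\sigma$ is a derangement). The deranged Bell number $\tilde{F}_n$ is the total number of deranged partitions of $[n]$ (over all $k$), with $\tilde{F}_0=1$. The ordered Bell (Fubini) number is $F_n=\sum_{k=0}^n k!\,{n\brace k}$, where ${n\brace k}$ is the Stirling number of the second kind (the number of partitions of $[n]$ into $k$ non-empty blocks); its exponential generating function is $1/(2-e^t)$. Empty sums are $0$. *)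

theory Defs
  imports "HOL-Combinatorics.Combinatorics" "HOL-Library.Disjoint_Sets"
begin

text \<open>The block listing \<open>Bs\<close> of a partition of \<open>[n]\<close>, in increasing order of block minima. Blocks are
  indexed from \<open>0\<close>, so the paper's \<open>B\<^sub>i\<close> is \<open>Bs ! (i - 1)\<close>.\<close>

definition ordered_partition :: "nat \<Rightarrow> nat set list \<Rightarrow> bool" where
  "ordered_partition n Bs \<longleftrightarrow>
     partition_on {1..n} (set Bs) \<and> sorted_wrt (\<lambda>B C. Min B < Min C) Bs"

text \<open>A deranged partition is the rearranged list of blocks itself; different \<open>Bs\<close> or \<open>\<sigma>\<close> producing
  the same list would be counted once. Entry \<open>i\<close> of \<open>permute_list \<sigma> Bs\<close> is \<open>Bs ! \<sigma> i\<close>.\<close>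

definition deranged_partitions :: "nat \<Rightarrow> nat set list set" where
  "deranged_partitions n =
     {permute_list \<sigma> Bs | \<sigma> Bs. ordered_partition n Bs \<and> \<sigma> permutes {..<length Bs} \<and>
        (\<forall>i<length Bs. Bs ! \<sigma> i \<noteq> Bs ! i)}"

definition deranged_bell :: "nat \<Rightarrow> nat" where
  "deranged_bell n = card (deranged_partitions n)"

definition ordered_bell :: "nat \<Rightarrow> nat" where
  "ordered_bell n = (\<Sum>k=0..n. fact k * Stirling n k)"

lemma finite_deranged_partitions: "finite (deranged_partitions n)"
proof (rule finite_subset)
  show "deranged_partitions n \<subseteq> {xs. set xs \<subseteq> Pow {1..n} \<and> distinct xs}"
  proof
    fix xs assume "xs \<in> deranged_partitions n"
    then obtain \<sigma> Bs where xs: "xs = permute_list \<sigma> Bs" and Bs: "ordered_partition n Bs"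
      and \<sigma>: "\<sigma> permutes {..<length Bs}"
      by (auto simp: deranged_partitions_def)
    have "sorted_wrt (<) (map Min Bs)"
      using Bs by (simp add: ordered_partition_def sorted_wrt_map)
    hence "distinct Bs"
      by (simp add: strict_sorted_iff distinct_map)
    moreover have "set Bs \<subseteq> Pow {1..n}"
      using Bs by (auto simp: ordered_partition_def partition_on_def)
    ultimately show "xs \<in> {xs. set xs \<subseteq> Pow {1..n} \<and> distinct xs}"
      using xs \<sigma> by simp
  qed
  show "finite {xs. set xs \<subseteq> Pow {1..n} \<and> distinct xs}"
    by (rule finite_subset_distinct) simp
qed

lemma deranged_bell_0: "deranged_bell 0 = 1"
proof -
  have "ordered_partition 0 Bs \<longleftrightarrow> Bs = []" for Bs
    by (auto simp: ordered_partition_def partition_on_empty)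
  hence "deranged_partitions 0 = {[]}"
    by (auto simp: deranged_partitions_def)
  thus ?thesis
    by (simp add: deranged_bell_def)
qed

text \<open>\<^const>\<open>Stirling\<close> is defined by its recurrence; it counts partitions into \<open>k\<close> blocks.\<close>

lemma card_partitions_insert:
  fixes A :: "'a set"
  assumes fin: "finite A" and a: "a \<notin> A"
  shows "card {P. partition_on (insert a A) P \<and> card P = Suc k} =
    Suc k * card {P. partition_on A P \<and> card P = Suc k} + card {P. partition_on A P \<and> card P = k}"
proof -
  define parts :: "'a set \<Rightarrow> nat \<Rightarrow> 'a set set set"
    where "parts = (\<lambda>X k. {P. partition_on X P \<and> card P = k})"
  define S where "S = (SIGMA P:parts A (Suc k). P)"
  define g where "g = (\<lambda>(P::'a set set, B). insert (insert a B) (P - {B}))"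
  have finparts: "finite (parts X j)" if "finite X" for X j
    by (rule finite_subset[OF _ finitely_many_partition_on[OF that]]) (auto simp: parts_def)
  have finP: "finite P" if "P \<in> parts A j" for P j
    using that finite_elements[OF fin] by (auto simp: parts_def)
  have notin: "a \<notin> B" if "P \<in> parts A j" "B \<in> P" for P B j
    using that a by (auto simp: parts_def partition_on_def)
  have gin: "g (P, B) \<in> parts (insert a A) (Suc k)" if P: "P \<in> parts A (Suc k)" "B \<in> P" for P B
  proof -
    have *: "partition_on A P" "card P = Suc k" using P by (auto simp: parts_def)
    have aB: "a \<notin> \<Union>P" using notin P by auto
    have d: "disjnt B (\<Union>(P - {B}))"
      using * P(2) by (auto simp: partition_on_def disjnt_def disjoint_def)
    have "partition_on A (insert B (P - {B}))"
      using * P(2) by (simp add: insert_absorb)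
    hence "partition_on (A - B) (P - {B})" "B \<subseteq> A"
      using partition_on_insert[OF d] by auto
    moreover have "disjnt (insert a B) (\<Union>(P - {B}))"
      using d aB by (auto simp: disjnt_iff)
    moreover have "insert a A - insert a B = A - B"
      using a by auto
    ultimately have "partition_on (insert a A) (insert (insert a B) (P - {B}))"
      by (subst partition_on_insert) auto
    moreover have "insert a B \<notin> P - {B}" using aB by auto
    hence "card (insert (insert a B) (P - {B})) = Suc k"
      using * finP[OF P(1)] P(2) by (simp add: card_Diff_singleton)
    ultimately show ?thesis by (simp add: parts_def g_def)
  qed
  have fin1: "insert {a} P \<in> parts (insert a A) (Suc k)" if P: "P \<in> parts A k" for P
  proof -
    have aB: "a \<notin> \<Union>P" using notin P by auto
    hence "disjnt {a} (\<Union>P)" by (auto simp: disjnt_iff)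
    moreover have "insert a A - {a} = A" using a by auto
    ultimately have "partition_on (insert a A) (insert {a} P)"
      using P by (subst partition_on_insert) (auto simp: parts_def)
    moreover have "{a} \<notin> P" using aB by auto
    hence "card (insert {a} P) = Suc k"
      using P finP[OF P] by (simp add: parts_def)
    ultimately show ?thesis by (simp add: parts_def)
  qed
  have split: "parts (insert a A) (Suc k) = insert {a} ` parts A k \<union> g ` S" (is "?L = ?R")
  proof
    show "?R \<subseteq> ?L" using gin fin1 by (auto simp: S_def)
    show "?L \<subseteq> ?R"
    proof
      fix Q assume "Q \<in> ?L"
      hence Q: "partition_on (insert a A) Q" "card Q = Suc k" by (auto simp: parts_def)
      have finQ: "finite Q" using Q fin finite_elements by blast
      obtain C where C: "C \<in> Q" "a \<in> C" using Q(1) by (auto simp: partition_on_def)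
      have d: "disjnt C (\<Union>(Q - {C}))"
        using Q C by (auto simp: partition_on_def disjnt_def disjoint_def)
      have "partition_on (insert a A) (insert C (Q - {C}))"
        using Q C by (simp add: insert_absorb)
      hence pc: "partition_on (insert a A - C) (Q - {C})" "C \<subseteq> insert a A"
        using partition_on_insert[OF d] by auto
      have cd: "card (Q - {C}) = k" using Q C finQ by (simp add: card_Diff_singleton)
      show "Q \<in> ?R"
      proof (cases "C = {a}")
        case True
        have "insert a A - C = A" using True a by auto
        hence "Q - {C} \<in> parts A k" using pc cd by (simp add: parts_def)
        moreover have "Q = insert {a} (Q - {C})" using True C by auto
        ultimately show ?thesis by blast
      next
        case False
        define B where "B = C - {a}"
        have CB: "C = insert a B" "a \<notin> B" using C by (auto simp: B_def)
        have Bne: "B \<noteq> {}" using False CB by auto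
        have dB: "disjnt B (\<Union>(Q - {C}))" using d by (auto simp: B_def disjnt_iff)
        have BQ: "B \<notin> Q - {C}"
        proof
          assume "B \<in> Q - {C}"
          hence "B \<subseteq> \<Union>(Q - {C})" by blast
          hence "B \<inter> \<Union>(Q - {C}) = B" by (rule Int_absorb2)
          with dB Bne show False by (simp add: disjnt_def)
        qed
        have "insert a A - C = A - B" using CB a by auto
        hence "partition_on A (insert B (Q - {C}))"
          using pc Bne CB by (subst partition_on_insert[OF dB]) auto
        moreover have "card (insert B (Q - {C})) = Suc k"
          using BQ cd finQ by simp
        ultimately have "(insert B (Q - {C}), B) \<in> S"
          by (simp add: S_def parts_def)
        moreover have "g (insert B (Q - {C}), B) = Q"
          using BQ C CB by (auto simp: g_def)
        ultimately have "Q \<in> g ` S" by (intro image_eqI[of Q g]) simp_all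
        thus ?thesis by simp
      qed
    qed
  qed
  have inj1: "inj_on (insert {a}) (parts A k)"
  proof (rule inj_onI)
    fix P P' assume P: "P \<in> parts A k" "P' \<in> parts A k" "insert {a} P = insert {a} P'"
    have "{a} \<notin> P" "{a} \<notin> P'" using notin P by blast+
    thus "P = P'" using P(3) by (simp add: insert_ident)
  qed
  have inj2: "inj_on g S"
  proof (rule inj_onI, clarify)
    fix P B P' B' assume PB: "(P, B) \<in> S" "(P', B') \<in> S" and eq: "g (P, B) = g (P', B')"
    have P: "P \<in> parts A (Suc k)" "B \<in> P" "P' \<in> parts A (Suc k)" "B' \<in> P'"
      using PB by (auto simp: S_def)
    have n: "\<And>X. X \<in> P \<Longrightarrow> a \<notin> X" "\<And>X. X \<in> P' \<Longrightarrow> a \<notin> X" using notin P by blast+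
    have eq': "insert (insert a B) (P - {B}) = insert (insert a B') (P' - {B'})"
      using eq by (simp add: g_def)
    have "insert a B \<in> insert (insert a B') (P' - {B'})"
      unfolding eq'[symmetric] by simp
    moreover have "insert a B \<notin> P'" using n(2)[of "insert a B"] by auto
    ultimately have "insert a B = insert a B'" by simp
    moreover have "a \<notin> B" "a \<notin> B'" using n P by auto
    ultimately have BB: "B = B'" by (simp add: insert_ident)
    have "insert a B \<notin> P - {B}" using n(1)[of "insert a B"] by auto
    moreover have "insert a B' \<notin> P' - {B'}" using n(2)[of "insert a B'"] by auto
    ultimately have "P - {B} = P' - {B'}" using eq' unfolding BB by (simp only: insert_ident not_False_eq_True)
    thus "P = P' \<and> B = B'" using BB P by blast
  qed
  have disj: "insert {a} ` parts A k \<inter> g ` S = {}"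
  proof (rule ccontr)
    assume "insert {a} ` parts A k \<inter> g ` S \<noteq> {}"
    then obtain P P' B where P: "P' \<in> parts A (Suc k)" "B \<in> P'"
      and eq: "insert {a} P = insert (insert a B) (P' - {B})"
      by (auto simp: S_def g_def)
    have "{a} \<notin> P'" using notin P by blast
    moreover have "{a} \<in> insert (insert a B) (P' - {B})"
      unfolding eq[symmetric] by simp
    ultimately have "{a} = insert a B" by simp
    moreover have "a \<notin> B" using notin P by blast
    ultimately have "B = {}" by auto
    thus False using P by (auto simp: parts_def partition_on_def)
  qed
  have finS: "finite S" unfolding S_def using finparts[OF fin] finP by (intro finite_SigmaI) auto
  have "card S = (\<Sum>P\<in>parts A (Suc k). card P)"
    unfolding S_def using finparts[OF fin] finP by (intro card_SigmaI) auto
  also have "\<dots> = Suc k * card (parts A (Suc k))"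
    by (simp add: parts_def)
  finally have "card (parts (insert a A) (Suc k)) =
      Suc k * card (parts A (Suc k)) + card (parts A k)"
    using finS finparts[OF fin] disj inj1 inj2
    by (simp add: split card_Un_disjoint card_image)
  thus ?thesis by (simp add: parts_def)
qed

lemma card_partitions_eq_Stirling:
  fixes A :: "'a set"
  assumes "finite A"
  shows "card {P. partition_on A P \<and> card P = k} = Stirling (card A) k"
  using assms
proof (induction A arbitrary: k rule: finite_induct)
  case empty
  show ?case
  proof (cases k)
    case 0
    have "{P. partition_on ({} :: 'a set) P \<and> card P = 0} = {{}}"
      by (auto simp: partition_on_empty)
    thus ?thesis using 0 by simp
  next
    case (Suc j)
    have "{P. partition_on ({} :: 'a set) P \<and> card P = Suc j} = {}"
      by (auto simp: partition_on_empty)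
    thus ?thesis using Suc by (simp only: card.empty Stirling.simps)
  qed
next
  case (insert a A)
  show ?case
  proof (cases k)
    case 0
    have "card P \<noteq> 0" if "partition_on (insert a A) P" for P
      using that insert.hyps(1) finite_elements[of "insert a A" P]
      by (auto simp: partition_on_def)
    hence *: "{P. partition_on (insert a A) P \<and> card P = k} = {}"
      using 0 by auto
    show ?thesis unfolding * using 0 insert.hyps by simp
  next
    case (Suc j)
    thus ?thesis using insert by (simp add: card_partitions_insert)
  qed
qed

end

theory Submission
  imports Defs "HOL-Computational_Algebra.Formal_Power_Series"
begin

text \<open>
  The identity is the coefficient form of a first-order differential equation between exponential
  generating functions.

  A deranged partition is a partition into some number \<open>k\<close> of blocks together with a derangement of
  the \<open>k\<close> blocks, so \<open>deranged_bell n\<close> is \<open>\<Sum>k\<le>n. D\<^sub>k * Stirling n k\<close> with \<open>D\<^sub>k\<close> the number of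
  derangements of a \<open>k\<close>-set (\<open>deranged_bell_eq_sum_Stirling\<close>); the ordered Bell numbers have the
  same form with \<open>k!\<close> in place of \<open>D\<^sub>k\<close>. On exponential generating functions, the transform
  \<open>a \<mapsto> (\<Sum>k\<le>n. a\<^sub>k * Stirling n k)\<close> is the substitution of \<open>e\<^sup>t - 1\<close> for the variable
  (\<open>egf_Stirling_transform\<close>), so it suffices to understand the generating functions \<open>D(x)\<close> of
  \<open>D\<^sub>k\<close> and \<open>G(x) = 1 / (1 - x)\<close> of \<open>k!\<close>.

  Sorting the permutations by the set of points that they move gives \<open>D(x) e\<^sup>x = G(x)\<close>.
  Differentiating and using \<open>G' = G\<^sup>2\<close> gives \<open>D' = D (G - 1)\<close>. After substituting \<open>x = e\<^sup>t - 1\<close>,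
  whose derivative is \<open>e\<^sup>t\<close>, the chain rule turns this into \<open>B' = e\<^sup>t B (F - 1)\<close> for the
  generating functions \<open>B\<close> of the deranged and \<open>F\<close> of the ordered Bell numbers. Comparing
  coefficients of \<open>t\<^sup>n / n!\<close> gives the claim: \<open>e\<^sup>t\<close> accounts for the outer binomial coefficient, and
  the missing constant term of \<open>F - 1\<close> for the restriction \<open>j < i\<close>.
\<close>

section \<open>Derangements\<close>

definition derangements :: "'a set \<Rightarrow> ('a \<Rightarrow> 'a) set" where
  "derangements A = {p. p permutes A \<and> (\<forall>x\<in>A. p x \<noteq> x)}"

definition derangement_number :: "nat \<Rightarrow> nat" where
  "derangement_number k = card (derangements {..<k})"

lemma finite_derangements: "finite A \<Longrightarrow> finite (derangements A)"
  by (rule finite_subset[OF _ finite_permutations]) (auto simp: derangements_def)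

lemma card_derangements:
  assumes "finite A"
  shows "card (derangements A) = derangement_number (card A)"
proof -
  obtain h where "bij_betw h A {..<card A}"
    using ex_bij_betw_finite_nat[OF assms] by (auto simp: atLeast0LessThan)
  from bij_betw_same_card[OF bij_betw_derangements[OF this]] show ?thesis
    by (simp add: derangement_number_def derangements_def)
qed

lemma derangements_moved_points: "p \<in> derangements U \<Longrightarrow> {x. p x \<noteq> x} = U"
  by (auto simp: derangements_def permutes_def)

lemma permutations_eq_UN_derangements: "{p. p permutes A} = (\<Union>U\<in>Pow A. derangements U)"
proof (intro equalityI subsetI)
  fix p assume "p \<in> {p. p permutes A}"
  hence p: "p permutes A" by simp
  define U where "U = {x. p x \<noteq> x}"
  have "U \<subseteq> A" "p permutes U"
    using p by (auto simp: U_def permutes_def)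
  thus "p \<in> (\<Union>U\<in>Pow A. derangements U)"
    by (auto simp: derangements_def U_def)
qed (auto simp: derangements_def intro: permutes_subset)

text \<open>Every permutation deranges exactly the set of points that it moves, and there are
  \<open>n choose j\<close> candidates with \<open>j\<close> elements for this set.\<close>

lemma sum_choose_derangement_number:
  "(\<Sum>j=0..n. (n choose j) * derangement_number j) = fact n"
proof -
  let ?A = "{..<n}"
  have "fact n = card {p. p permutes ?A}"
    using card_permutations[of ?A n] by simp
  also have "\<dots> = (\<Sum>U\<in>Pow ?A. card (derangements U))"
    unfolding permutations_eq_UN_derangements
    by (intro card_UN_disjoint)
      (auto intro: finite_derangements finite_subset dest: derangements_moved_points)
  also have "\<dots> = (\<Sum>U\<in>Pow ?A. derangement_number (card U))"
    by (intro sum.cong card_derangements) (auto intro: finite_subset)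
  also have "\<dots> = (\<Sum>j=0..n. \<Sum>U | U \<in> Pow ?A \<and> card U = j. derangement_number (card U))"
    using card_mono[of ?A] by (intro sum.group[symmetric]) auto
  also have "\<dots> = (\<Sum>j=0..n. (n choose j) * derangement_number j)"
    using n_subsets[of ?A] by (intro sum.cong) auto
  finally show ?thesis ..
qed

section \<open>Deranged partitions and Stirling numbers\<close>

lemma inj_on_Min_partition:
  fixes P :: "'a::linorder set set"
  assumes P: "partition_on A P" and A: "finite A"
  shows "inj_on Min P"
proof (rule inj_onI)
  fix B C assume BC: "B \<in> P" "C \<in> P" "Min B = Min C"
  have "Min X \<in> X" if "X \<in> P" for X
    using P A that by (intro Min_in) (auto simp: partition_on_def intro: finite_subset)
  hence "B \<inter> C \<noteq> {}" using BC by (metis disjoint_iff)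
  thus "B = C"
    using P BC by (auto simp: partition_on_def disjoint_def)
qed

lemma ordered_partition_distinct: "ordered_partition n Bs \<Longrightarrow> distinct Bs"
  by (auto simp: ordered_partition_def distinct_map strict_sorted_iff
      simp flip: sorted_wrt_map[of "(<)" Min])

text \<open>The blocks of a partition are pairwise disjoint, so their minima are distinct, and there is
  exactly one way to list the blocks by increasing minimum.\<close>

lemma bij_betw_ordered_partition:
  "bij_betw set {Bs. ordered_partition n Bs} {P. partition_on {1..n} P}"
proof (rule bij_betwI')
  fix Bs Cs assume "Bs \<in> {Bs. ordered_partition n Bs}" "Cs \<in> {Bs. ordered_partition n Bs}"
  hence *: "partition_on {1..n} (set Bs)" "sorted_wrt (<) (map Min Bs)"
      "sorted_wrt (<) (map Min Cs)"
    by (auto simp: ordered_partition_def sorted_wrt_map)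
  show "set Bs = set Cs \<longleftrightarrow> Bs = Cs"
  proof
    assume eq: "set Bs = set Cs"
    have "map Min Bs = map Min Cs"
      using * eq by (intro strict_sorted_equal) auto
    thus "Bs = Cs"
      using inj_on_Min_partition[OF *(1)] eq by (auto dest: map_inj_on)
  qed simp
next
  fix Bs assume "Bs \<in> {Bs. ordered_partition n Bs}"
  thus "set Bs \<in> {P. partition_on {1..n} P}"
    by (simp add: ordered_partition_def)
next
  fix P assume "P \<in> {P. partition_on {1..n} P}"
  hence P: "partition_on {1..n} P" by simp
  have fin: "finite P" using finite_elements[OF _ P] by simp
  have inj: "inj_on Min P" using inj_on_Min_partition[OF P] by simp
  define Bs where "Bs = map (inv_into P Min) (sorted_list_of_set (Min ` P))"
  have set: "set Bs = P"
    using fin inj by (simp add: Bs_def)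
  have "map Min Bs = sorted_list_of_set (Min ` P)"
    using fin by (auto simp: Bs_def f_inv_into_f intro!: map_idI)
  hence "sorted_wrt (<) (map Min Bs)" by simp
  hence "ordered_partition n Bs"
    using P set by (simp add: ordered_partition_def sorted_wrt_map)
  thus "\<exists>Bs\<in>{Bs. ordered_partition n Bs}. P = set Bs"
    using set by blast
qed

text \<open>The rearranged list determines its set of blocks, hence the sorted listing, and then the
  permutation because the blocks are distinct.\<close>

lemma bij_betw_deranged_partitions:
  "bij_betw (\<lambda>(Bs, \<sigma>). permute_list \<sigma> Bs)
     (SIGMA Bs:{Bs. ordered_partition n Bs}. derangements {..<length Bs}) (deranged_partitions n)"
  (is "bij_betw ?f ?S _")
proof (rule bij_betw_imageI)
  show "inj_on ?f ?S"
  proof (rule inj_onI, clarify)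
    fix Bs \<sigma> Cs \<tau>
    assume Bs: "ordered_partition n Bs" "\<sigma> \<in> derangements {..<length Bs}"
      and Cs: "ordered_partition n Cs" "\<tau> \<in> derangements {..<length Cs}"
      and eq: "permute_list \<sigma> Bs = permute_list \<tau> Cs"
    have perm: "\<sigma> permutes {..<length Bs}" "\<tau> permutes {..<length Cs}"
      using Bs Cs by (auto simp: derangements_def)
    have "set Bs = set Cs"
      using perm arg_cong[OF eq, of set] by simp
    hence BC: "Bs = Cs"
      using bij_betw_ordered_partition[of n] Bs Cs by (auto simp: bij_betw_def inj_on_def)
    have "\<sigma> i = \<tau> i" for i
    proof (cases "i < length Bs")
      case True
      have "Bs ! \<sigma> i = Bs ! \<tau> i"
        using arg_cong[OF eq, of "\<lambda>xs. xs ! i"] perm True by (simp add: BC permute_list_nth)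
      moreover have "\<sigma> i < length Bs" "\<tau> i < length Bs"
        using perm True BC permutes_in_image by fastforce+
      ultimately show ?thesis
        using ordered_partition_distinct[OF Bs(1)] by (simp add: nth_eq_iff_index_eq)
    next
      case False
      thus ?thesis using perm BC by (simp add: permutes_not_in)
    qed
    thus "Bs = Cs \<and> \<sigma> = \<tau>" using BC by auto
  qed
  have "(\<forall>i<length Bs. Bs ! \<sigma> i \<noteq> Bs ! i) \<longleftrightarrow> (\<forall>i\<in>{..<length Bs}. \<sigma> i \<noteq> i)"
    if "ordered_partition n Bs" "\<sigma> permutes {..<length Bs}" for Bs \<sigma>
  proof -
    have "\<sigma> i < length Bs" if "i < length Bs" for i
      using permutes_in_image[OF \<open>\<sigma> permutes _\<close>, of i] that by simp
    thus ?thesis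
      using ordered_partition_distinct[OF that(1)] by (auto simp: nth_eq_iff_index_eq)
  qed
  hence "deranged_partitions n = {permute_list \<sigma> Bs | \<sigma> Bs.
      ordered_partition n Bs \<and> \<sigma> \<in> derangements {..<length Bs}}"
    unfolding deranged_partitions_def derangements_def by (smt (verit) Collect_cong mem_Collect_eq)
  thus "?f ` ?S = deranged_partitions n"
    by (auto simp: image_iff)
qed

lemma deranged_bell_eq_sum_Stirling:
  "deranged_bell n = (\<Sum>k=0..n. derangement_number k * Stirling n k)"
proof -
  let ?Ps = "{P. partition_on {1..n} P}"
  have fin: "finite ?Ps"
    by (simp add: finitely_many_partition_on)
  have fin_ord: "finite {Bs. ordered_partition n Bs}"
    using bij_betw_finite[OF bij_betw_ordered_partition] fin by blast
  have card_le: "card P \<le> n" if "partition_on {1..n} P" for P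
  proof -
    have "card P = card (Min ` P)"
      using inj_on_Min_partition[OF that] by (simp add: card_image)
    also have "Min B \<in> {1..n}" if "B \<in> P" for B
    proof -
      have "B \<subseteq> {1..n}" "B \<noteq> {}"
        using \<open>partition_on {1..n} P\<close> that by (auto simp: partition_on_def)
      thus ?thesis using Min_in[of B] finite_subset[of B "{1..n}"] by blast
    qed
    hence "card (Min ` P) \<le> card {1..n}" by (intro card_mono) auto
    finally show ?thesis by simp
  qed
  have "deranged_bell n = card (SIGMA Bs:{Bs. ordered_partition n Bs}. derangements {..<length Bs})"
    unfolding deranged_bell_def by (rule bij_betw_same_card[OF bij_betw_deranged_partitions, symmetric])
  also have "\<dots> = (\<Sum>Bs | ordered_partition n Bs. derangement_number (length Bs))"
    using fin_ord by (subst card_SigmaI) (auto simp: finite_derangements derangement_number_def)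
  also have "\<dots> = (\<Sum>Bs | ordered_partition n Bs. derangement_number (card (set Bs)))"
    by (intro sum.cong) (auto simp: distinct_card ordered_partition_distinct)
  also have "\<dots> = (\<Sum>P\<in>?Ps. derangement_number (card P))"
    by (rule sum.reindex_bij_betw[OF bij_betw_ordered_partition])
  also have "\<dots> = (\<Sum>k=0..n. \<Sum>P | P \<in> ?Ps \<and> card P = k. derangement_number (card P))"
    using fin card_le by (intro sum.group[symmetric]) auto
  also have "\<dots> = (\<Sum>k=0..n. derangement_number k * Stirling n k)"
    using card_partitions_eq_Stirling[of "{1..n}"] by (intro sum.cong) auto
  finally show ?thesis .
qed

section \<open>Exponential generating functions\<close>

unbundle fps_syntax

definition egf :: "(nat \<Rightarrow> nat) \<Rightarrow> real fps" where
  "egf a = Abs_fps (\<lambda>n. of_nat (a n) / fact n)"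

lemma egf_nth [simp]: "egf a $ n = of_nat (a n) / fact n"
  by (simp add: egf_def)

lemma fps_deriv_egf_nth: "fps_deriv (egf a) $ n = of_nat (a (Suc n)) / fact n"
  by (simp add: divide_simps)

lemma egf_mult_nth:
  fixes f g :: "nat \<Rightarrow> real"
  assumes "\<And>n. A $ n = f n / fact n" "\<And>n. B $ n = g n / fact n"
  shows "(A * B) $ n = (\<Sum>i=0..n. of_nat (n choose i) * f i * g (n - i)) / fact n"
  unfolding fps_mult_nth sum_divide_distrib
  by (intro sum.cong) (simp_all add: assms binomial_fact)

abbreviation exp_minus_one :: "real fps" where
  "exp_minus_one \<equiv> fps_exp 1 - 1"

text \<open>Differentiating \<open>(e\<^sup>t - 1)\<^sup>k\<close> gives \<open>k ((e\<^sup>t - 1)\<^sup>k + (e\<^sup>t - 1)\<^bsup>k-1\<^esup>)\<close>, which is the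
  recurrence of the Stirling numbers.\<close>

lemma exp_minus_one_power_nth:
  "(exp_minus_one ^ k) $ n = fact k * of_nat (Stirling n k) / fact n"
proof (induction n arbitrary: k)
  case 0
  show ?case by (cases k) (simp_all add: fps_power_zeroth)
next
  case (Suc n)
  show ?case
  proof (cases k)
    case 0
    thus ?thesis by simp
  next
    case [simp]: (Suc j)
    have "fps_deriv (exp_minus_one ^ k) = of_nat k * fps_exp 1 * exp_minus_one ^ j"
      using fps_deriv_power'[of exp_minus_one k] by (simp del: power_Suc of_nat_Suc)
    also have "\<dots> = of_nat k * (exp_minus_one ^ k + exp_minus_one ^ j)"
      by (simp add: algebra_simps)
    finally have "fps_deriv (exp_minus_one ^ k) $ n =
        of_nat k * ((exp_minus_one ^ k) $ n + (exp_minus_one ^ j) $ n)"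
      by (simp only: fps_of_nat[symmetric] fps_mult_left_const_nth fps_add_nth)
    hence "of_nat (Suc n) * (exp_minus_one ^ k) $ Suc n =
        of_nat k * ((exp_minus_one ^ k) $ n + (exp_minus_one ^ j) $ n)"
      by (simp only: fps_deriv_nth Suc_eq_plus1)
    also have "\<dots> = of_nat (Suc n) * (fact k * of_nat (Stirling (Suc n) k) / fact (Suc n))"
    proof -
      have cancel: "of_nat (Suc n) * (x / fact (Suc n)) = x / fact n" for x :: real
        by (simp del: of_nat_Suc)
      show ?thesis
        unfolding Suc.IH cancel by (simp add: field_simps)
    qed
    finally show ?thesis
      by (simp only: mult_cancel_left of_nat_neq_0 simp_thms)
  qed
qed

lemma egf_Stirling_transform:
  "egf a oo exp_minus_one = egf (\<lambda>n. \<Sum>k=0..n. a k * Stirling n k)"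
  by (rule fps_ext)
    (simp add: fps_compose_nth exp_minus_one_power_nth sum_divide_distrib)

lemma egf_deranged_bell: "egf deranged_bell = egf derangement_number oo exp_minus_one"
  by (simp add: egf_Stirling_transform flip: deranged_bell_eq_sum_Stirling)

lemma egf_ordered_bell: "egf ordered_bell = egf fact oo exp_minus_one"
  by (simp add: egf_Stirling_transform flip: ordered_bell_def)

lemma egf_fact_mult: "egf fact * (1 - fps_X) = 1"
  by (rule fps_ext) (simp add: algebra_simps)

text \<open>With \<open>G = egf fact\<close>, differentiating \<open>G (1 - x) = 1\<close> gives \<open>G' (1 - x) = G\<close>; multiply by \<open>G\<close>.\<close>

lemma fps_deriv_egf_fact: "fps_deriv (egf fact) = egf fact * egf fact"
proof -
  have "fps_deriv (egf fact * (1 - fps_X)) = 0"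
    by (simp only: egf_fact_mult fps_deriv_1)
  hence "fps_deriv (egf fact) * (1 - fps_X) = egf fact"
    by (simp add: algebra_simps)
  hence "(fps_deriv (egf fact) * (1 - fps_X)) * egf fact = egf fact * egf fact"
    by (simp only:)
  hence "fps_deriv (egf fact) * (egf fact * (1 - fps_X)) = egf fact * egf fact"
    by (simp only: ac_simps)
  thus ?thesis by (simp only: egf_fact_mult mult_1_right)
qed

lemma egf_derangement_number_mult_exp: "egf derangement_number * fps_exp 1 = egf fact"
proof (rule fps_ext)
  fix n
  have "(egf derangement_number * fps_exp 1) $ n =
      (\<Sum>i=0..n. of_nat (n choose i) * of_nat (derangement_number i) * 1) / fact n"
    by (rule egf_mult_nth) simp_all
  also have "\<dots> = of_nat (\<Sum>i=0..n. (n choose i) * derangement_number i) / fact n"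
    by simp
  finally show "(egf derangement_number * fps_exp 1) $ n = egf fact $ n"
    unfolding sum_choose_derangement_number by simp
qed

text \<open>Let \<open>D = egf derangement_number\<close> and \<open>G = egf fact\<close>. Differentiating \<open>D e\<^sup>x = G\<close> gives
  \<open>(D' + D) e\<^sup>x = G' = G\<^sup>2 = G D e\<^sup>x\<close>, and \<open>e\<^sup>x\<close> cancels.\<close>

lemma fps_deriv_egf_derangement_number:
  "fps_deriv (egf derangement_number) = egf derangement_number * (egf fact - 1)"
proof -
  let ?D = "egf derangement_number"
  have "(fps_deriv ?D + ?D) * fps_exp 1 = fps_deriv (?D * fps_exp 1)"
    by (simp add: algebra_simps)
  also have "\<dots> = egf fact * (?D * fps_exp 1)"
    by (simp only: egf_derangement_number_mult_exp fps_deriv_egf_fact)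
  finally have "(fps_deriv ?D + ?D) * fps_exp 1 = (egf fact * ?D) * fps_exp 1"
    by (simp only: mult.assoc)
  hence "fps_deriv ?D + ?D = egf fact * ?D"
    by simp
  thus ?thesis by (simp add: algebra_simps eq_diff_eq)
qed

lemma fps_deriv_egf_deranged_bell:
  "fps_deriv (egf deranged_bell) = (egf deranged_bell * (egf ordered_bell - 1)) * fps_exp 1"
  by (simp add: egf_deranged_bell egf_ordered_bell fps_compose_deriv
      fps_deriv_egf_derangement_number fps_compose_mult_distrib fps_compose_sub_distrib)

section \<open>The recurrence\<close>

theorem corollary4p3:
  fixes n :: nat
  shows "deranged_bell (n + 1) =
    (\<Sum>i=0..n. \<Sum>j=0..<i. (n choose i) * (i choose j) * deranged_bell j * ordered_bell (i - j))"
proof -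
  \<comment> \<open>The ordered Bell numbers without the \<open>m = 0\<close> term, as counted by \<open>egf ordered_bell - 1\<close>.\<close>
  let ?f = "\<lambda>m. if m = 0 then 0 else ordered_bell m"
  define c where "c i = (\<Sum>j=0..<i. (i choose j) * deranged_bell j * ordered_bell (i - j))" for i
  have F: "(egf ordered_bell - 1) $ m = of_nat (?f m) / fact m" for m
    by (simp add: ordered_bell_def)
  have inner: "(egf deranged_bell * (egf ordered_bell - 1)) $ i = of_nat (c i) / fact i" for i
  proof -
    have "(egf deranged_bell * (egf ordered_bell - 1)) $ i =
        (\<Sum>j=0..i. of_nat (i choose j) * of_nat (deranged_bell j) * of_nat (?f (i - j))) / fact i"
      by (rule egf_mult_nth[OF egf_nth F])
    also have "(\<Sum>j=0..i. of_nat (i choose j) * of_nat (deranged_bell j) * of_nat (?f (i - j))) =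
        (of_nat (\<Sum>j=0..i. (i choose j) * deranged_bell j * ?f (i - j)) :: real)"
      by (simp only: of_nat_sum of_nat_mult)
    also have "(\<Sum>j=0..i. (i choose j) * deranged_bell j * ?f (i - j)) = c i"
      unfolding c_def by (intro sum.mono_neutral_cong_right) auto
    finally show ?thesis .
  qed
  have "of_nat (deranged_bell (n + 1)) / fact n = fps_deriv (egf deranged_bell) $ n"
    by (simp only: fps_deriv_egf_nth Suc_eq_plus1)
  also have "\<dots> = (\<Sum>i=0..n. of_nat (n choose i) * of_nat (c i) * (1 :: real)) / fact n"
    unfolding fps_deriv_egf_deranged_bell by (rule egf_mult_nth[OF inner]) simp
  also have "\<dots> = of_nat (\<Sum>i=0..n. (n choose i) * c i) / fact n"
    by simp
  finally have "deranged_bell (n + 1) = (\<Sum>i=0..n. (n choose i) * c i)"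
    by (simp only: divide_cancel_right fact_nonzero of_nat_eq_iff simp_thms)
  thus ?thesis
    by (simp add: c_def sum_distrib_left mult.assoc)
qed

end
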